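(* Let $\alpha>0$. For every weighted multigraph $G$ and every $i,j\in V(G)$, $$\widetilde{\rho}_{ij}(G')=2d^{\alpha}_{ij}(G),$$ where $G'$ is the $\alpha$-extension of $G$, $\widetilde{\rho}_{ij}(G')$ is the resistance distance on $G'$, and $d^{\alpha}_{ij}(G)$ is the forest distance on $G$ with parameter $\alpha$.
   Context: A weighted multigraph $G$ has finite vertex set $V(G)=\{1,\ldots,n\}$; multiple edges are allowed, loops are not, and all edge weights are strictly positive. Its Laplacian matrix $L=L(G)=(\ell_{ij})$ is given by: for $j\ne i$, $\ell_{ij}$ is minus the sum of the weights of all edges with terminal vertices $i$ and $j$; and $\ell_{ii}=-\sum_{j\neq i}\ell_{ij}$. For a parameter $\alpha>0$, the relative forest accessibility matrix is $Q_\alpha=(q^{\alpha}_{ij})=(I+\alpha L)^{-1}$, and the forest distance on $G$ is $d^{\alpha}_{ij}(G)=\frac12(q^{\alpha}_{ii}+q^{\alpha}_{jj}-q^{\alpha}_{ij}-q^{\alpha}_{ji})$. The resistance distance on a weighted multigraph $H$ with Laplacian matrix $L(H)$ (defined analogously on its vertex set) takes values in $\mathbb{R}\cup\{+\infty\}$: if $i$ and $j$ belong to different components of $H$, then $\widetilde{\rho}_{ij}(H)=+\infty$; otherwise $\widetilde{\rho}_{ij}(H)=\ell^{+}_{ii}+\ell^{+}_{jj}-\ell^{+}_{ij}-\ell^{+}_{ji}$, where $\ell^{+}_{ij}$ are the entries of the Moore--Penrose generalized inverse of $L(H)$. The $\alpha$-extension of $G$ is the weighted multigraph $G'$ such that (i)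 $V(G')=V(G)\cup\{0\}$, where $0$ is a new vertex; (ii) the restriction of the edge set $E(G')$ to $V(G)$ coincides with $E(G)$, and the weight of each such edge in $G'$ is $\alpha$ times its weight in $G$; (iii) $E(G')$ contains one edge $(0,i)$ of weight $1$ for each vertex $i\in V(G)$ (and no other edges). *)

theory Defs
  imports "HOL-Analysis.Analysis" "HOL-Library.Multiset"
begin

text \<open>
  A weighted multigraph whose vertices are the elements of a finite type is given by its
  multiset of edges, each edge being an unordered pair of vertices together with a weight.
  Parallel edges may have equal or different weights.
\<close>

type_synonym 'v wgraph = "('v set \<times> real) multiset"

definition weighted_multigraph :: "'v wgraph \<Rightarrow> bool" where
  "weighted_multigraph G \<longleftrightarrow> (\<forall>(e, w) \<in># G. card e = 2 \<and> w > 0)"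

definition edge_weight :: "'v wgraph \<Rightarrow> 'v \<Rightarrow> 'v \<Rightarrow> real" where
  "edge_weight G i j = (\<Sum>(e, w) \<in># filter_mset (\<lambda>(e, w). e = {i, j}) G. w)"

definition laplacian :: "('v::finite) wgraph \<Rightarrow> real^'v^'v" where
  "laplacian G = (\<chi> i j. if i = j then (\<Sum>k \<in> UNIV - {i}. edge_weight G i k)
                                 else - edge_weight G i j)"

lemma laplacian_diagonal:
  "laplacian G $ i $ i = - (\<Sum>j \<in> UNIV - {i}. laplacian G $ i $ j)"
  by (simp add: laplacian_def sum_negf)

definition forest_accessibility :: "real \<Rightarrow> ('v::finite) wgraph \<Rightarrow> real^'v^'v" where
  "forest_accessibility \<alpha> G = matrix_inv (mat 1 + \<alpha> *\<^sub>R laplacian G)"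

definition forest_distance :: "real \<Rightarrow> ('v::finite) wgraph \<Rightarrow> 'v \<Rightarrow> 'v \<Rightarrow> real" where
  "forest_distance \<alpha> G i j =
     (let Q = forest_accessibility \<alpha> G
      in (1/2) * (Q $ i $ i + Q $ j $ j - Q $ i $ j - Q $ j $ i))"

definition is_moore_penrose :: "real^'n^'m \<Rightarrow> real^'m^'n \<Rightarrow> bool" where
  "is_moore_penrose A X \<longleftrightarrow>
     A ** X ** A = A \<and> X ** A ** X = X \<and>
     transpose (A ** X) = A ** X \<and> transpose (X ** A) = X ** A"

definition moore_penrose :: "real^'n^'m \<Rightarrow> real^'m^'n" where
  "moore_penrose A = (THE X. is_moore_penrose A X)"

lemma is_moore_penrose_unique:
  fixes A :: "real^'n^'m"
  assumes "is_moore_penrose A X" and "is_moore_penrose A Y"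
  shows "X = Y"
proof -
  note X = assms(1)[unfolded is_moore_penrose_def]
  note Y = assms(2)[unfolded is_moore_penrose_def]
  have "A ** X = transpose (A ** X)" using X by simp
  also have "\<dots> = transpose ((A ** Y) ** (A ** X))"
    using Y by (metis matrix_mul_assoc)
  also have "\<dots> = (A ** X) ** (A ** Y)"
    using X Y by (simp add: matrix_transpose_mul)
  also have "\<dots> = A ** Y" using X by (metis matrix_mul_assoc)
  finally have AX: "A ** X = A ** Y" .
  have "X ** A = transpose (X ** A)" using X by simp
  also have "\<dots> = transpose ((X ** A) ** (Y ** A))"
    using Y by (metis matrix_mul_assoc)
  also have "\<dots> = (Y ** A) ** (X ** A)"
    using X Y by (simp add: matrix_transpose_mul)
  also have "\<dots> = Y ** A" using X by (metis matrix_mul_assoc)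
  finally have XA: "X ** A = Y ** A" .
  show ?thesis using X Y AX XA by (metis matrix_mul_assoc)
qed

lemma transpose_eq_selfI:
  fixes M :: "real^'n^'n"
  assumes "\<And>v w. (M *v v) \<bullet> w = v \<bullet> (M *v w)"
  shows "transpose M = M"
proof -
  have "(transpose M *v v) \<bullet> w = (M *v v) \<bullet> w" for v w
    by (simp add: assms dot_lmul_matrix)
  then show ?thesis
    by (metis matrix_eq vector_eq_rdot)
qed

lemma is_moore_penrose_exists:
  fixes A :: "real^'n^'m"
  shows "\<exists>X. is_moore_penrose A X"
proof -
  define R where "R = range ((*v) (transpose A))"
  define S where "S = range ((*v) A)"
  have subR: "subspace R" and subS: "subspace S"
    unfolding R_def S_def
    by (rule linear_subspace_image[OF matrix_vector_mul_linear subspace_UNIV])+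
  have adj: "x \<bullet> (transpose A *v u) = (A *v x) \<bullet> u" for x u
    by (metis dot_lmul_matrix inner_commute transpose_matrix_vector)
  define P where "P b x \<longleftrightarrow> x \<in> R \<and> (\<forall>z. (A *v x - b) \<bullet> (A *v z) = 0)" for b x
  have ex: "\<exists>x. P b x" for b
  proof -
    obtain y z where yz: "y \<in> span S" "\<And>w. w \<in> span S \<Longrightarrow> orthogonal z w" "b = y + z"
      using orthogonal_subspace_decomp_exists[of S b] by metis
    have "y \<in> S" using yz(1) subS by (metis span_eq_iff)
    then obtain x1 where x1: "y = A *v x1" by (auto simp: S_def)
    obtain x2 k where xk: "x2 \<in> span R" "\<And>w. w \<in> span R \<Longrightarrow> orthogonal k w" "x1 = x2 + k"
      using orthogonal_subspace_decomp_exists[of R x1] by metis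
    have "(A *v k) \<bullet> (A *v k) = 0"
      using xk(2)[of "transpose A *v (A *v k)"] adj[of k "A *v k"]
      by (simp add: orthogonal_def R_def span_base)
    then have "A *v x2 = y" by (simp add: x1 xk(3) matrix_vector_right_distrib)
    moreover have "z \<bullet> (A *v w) = 0" for w
      using yz(2)[of "A *v w"] by (simp add: orthogonal_def S_def span_base)
    ultimately have "P b x2"
      using xk(1) subR unfolding P_def yz(3)
      by (metis add_diff_cancel_left' inner_minus_left minus_diff_eq neg_equal_0_iff_equal span_eq_iff)
    then show ?thesis ..
  qed
  have uniq: "x = x'" if "P b x" "P b x'" for b x x'
  proof -
    have "x - x' \<in> R" using that subR by (auto simp: P_def intro: subspace_diff)
    then obtain u where u: "x - x' = transpose A *v u" by (auto simp: R_def)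
    have "(A *v (x - x')) \<bullet> (A *v (x - x')) = (A *v x - b) \<bullet> (A *v (x - x')) - (A *v x' - b) \<bullet> (A *v (x - x'))"
      by (simp add: matrix_vector_mult_diff_distrib inner_diff_left inner_diff_right)
    also have "\<dots> = 0" using that by (simp add: P_def)
    finally have "A *v (x - x') = 0" by simp
    then have "(x - x') \<bullet> (x - x') = 0" using adj[of "x - x'" u] u by simp
    then show ?thesis by simp
  qed
  define f where "f b = (SOME x. P b x)" for b
  have f: "P b (f b)" for b unfolding f_def using ex by (rule someI_ex)
  have feq: "f b = x" if "P b x" for b x using uniq f that by blast
  have "linear f"
  proof (rule linearI)
    fix b c
    have "P (b + c) (f b + f c)"
      unfolding P_def
    proof (intro conjI allI)
      show "f b + f c \<in> R" using f[of b] f[of c] subR by (auto simp: P_def intro: subspace_add)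
      fix z
      have "(A *v f b - b) \<bullet> (A *v z) = 0" "(A *v f c - c) \<bullet> (A *v z) = 0"
        using f[of b] f[of c] by (auto simp: P_def)
      then show "(A *v (f b + f c) - (b + c)) \<bullet> (A *v z) = 0"
        by (simp add: matrix_vector_right_distrib inner_diff_left inner_add_left)
    qed
    then show "f (b + c) = f b + f c" by (rule feq)
  next
    fix r b
    have "P (r *\<^sub>R b) (r *\<^sub>R f b)"
      unfolding P_def
    proof (intro conjI allI)
      show "r *\<^sub>R f b \<in> R" using f[of b] subR by (auto simp: P_def intro: subspace_mul)
      fix z
      have "(A *v f b - b) \<bullet> (A *v z) = 0" using f[of b] by (auto simp: P_def)
      then show "(A *v (r *\<^sub>R f b) - r *\<^sub>R b) \<bullet> (A *v z) = 0"
        by (simp add: matrix_vector_mult_scaleR flip: scaleR_diff_right)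
    qed
    then show "f (r *\<^sub>R b) = r *\<^sub>R f b" by (rule feq)
  qed
  define X where "X = matrix f"
  have X: "X *v b = f b" for b
    unfolding X_def using \<open>linear f\<close> by (simp add: matrix_works)
  have XR: "X *v b \<in> R" and orth: "(A *v (X *v b) - b) \<bullet> (A *v z) = 0" for b z
    using f[of b] by (auto simp: P_def X)
  have AXA: "A *v (X *v (A *v v)) = A *v v" for v
  proof -
    have "(A *v (X *v (A *v v)) - A *v v) \<bullet> (A *v (X *v (A *v v) - v)) = 0" by (rule orth)
    then show ?thesis by (simp add: matrix_vector_mult_diff_distrib)
  qed
  have XAX: "X *v (A *v (X *v b)) = X *v b" for b
    unfolding X[of "A *v (X *v b)"] by (rule feq) (simp add: P_def XR)
  have symAX: "(A *v (X *v v)) \<bullet> w = (A *v (X *v v)) \<bullet> (A *v (X *v w))" for v w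
    using orth[of w "X *v v"] by (simp add: inner_diff_left inner_diff_right inner_commute)
  have symXA: "v \<bullet> (X *v (A *v w)) = (X *v (A *v v)) \<bullet> (X *v (A *v w))" for v w
  proof -
    obtain u where u: "X *v (A *v w) = transpose A *v u" using XR by (auto simp: R_def)
    show ?thesis unfolding u adj AXA ..
  qed
  have "is_moore_penrose A X"
    unfolding is_moore_penrose_def
  proof (intro conjI transpose_eq_selfI)
    show "A ** X ** A = A" "X ** A ** X = X"
      by (simp_all add: matrix_eq AXA XAX flip: matrix_vector_mul_assoc)
    show "((A ** X) *v v) \<bullet> w = v \<bullet> ((A ** X) *v w)" for v w
      using symAX[of v w] symAX[of w v]
      by (simp add: inner_commute flip: matrix_vector_mul_assoc)
    show "((X ** A) *v v) \<bullet> w = v \<bullet> ((X ** A) *v w)" for v w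
      using symXA[of v w] symXA[of w v]
      by (simp add: inner_commute flip: matrix_vector_mul_assoc)
  qed
  then show ?thesis ..
qed

lemma is_moore_penrose_moore_penrose: "is_moore_penrose A (moore_penrose A)"
  unfolding moore_penrose_def
  by (rule theI') (use is_moore_penrose_exists is_moore_penrose_unique in blast)

definition same_component :: "'v wgraph \<Rightarrow> 'v \<Rightarrow> 'v \<Rightarrow> bool" where
  "same_component G i j \<longleftrightarrow> (i, j) \<in> {(u, v). \<exists>w. ({u, v}, w) \<in># G}\<^sup>*"

definition resistance_distance :: "('v::finite) wgraph \<Rightarrow> 'v \<Rightarrow> 'v \<Rightarrow> ereal" where
  "resistance_distance G i j =
     (if same_component G i j
      then let P = moore_penrose (laplacian G)
           in ereal (P $ i $ i + P $ j $ j - P $ i $ j - P $ j $ i)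
      else \<infinity>)"

text \<open>
  The new vertex is \<^const>\<open>None\<close>, and an old vertex \<^term>\<open>i\<close> becomes \<^term>\<open>Some i\<close>.
\<close>

definition alpha_extension :: "real \<Rightarrow> ('v::finite) wgraph \<Rightarrow> 'v option wgraph" where
  "alpha_extension \<alpha> G =
     image_mset (\<lambda>(e, w). (Some ` e, \<alpha> * w)) G
     + image_mset (\<lambda>i. ({None, Some i}, 1)) (mset_set UNIV)"

lemma weighted_multigraph_alpha_extension:
  assumes "\<alpha> > 0" and "weighted_multigraph G"
  shows "weighted_multigraph (alpha_extension \<alpha> G)"
  using assms unfolding weighted_multigraph_def alpha_extension_def
  by (auto simp: card_image)

end

theory Submission
  imports Defs
begin

text \<open>
  Write \<open>L'\<close> for the Laplacian of the extension, \<open>A = I + \<alpha>L\<close> and \<open>u = e\<^sub>i - e\<^sub>j\<close>. The block of \<open>L'\<close>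
  on the old vertices is \<open>A\<close>, and the remaining off-diagonal entries are \<open>-1\<close>. The solution \<open>x\<close>
  of \<open>Ax = u\<close> has coordinate sum \<open>0\<close>, since the columns of \<open>A\<close> sum to \<open>1\<close>; hence \<open>x\<close> extended
  by \<open>0\<close> is a potential \<open>y\<close> with \<open>L'y\<close> equal to the extension of \<open>u\<close> by \<open>0\<close>. For symmetric \<open>L'\<close> the
  Moore--Penrose inverse \<open>P\<close> satisfies \<open>(L'y) \<bullet> P(L'y) = y \<bullet> L'y\<close>, so the resistance is
  \<open>x \<bullet> u = u \<bullet> A\<inverse>u\<close>.
\<close>

lemma edge_weight_commute: "edge_weight G i j = edge_weight G j i"
  by (simp add: edge_weight_def insert_commute)

lemma sum_mset_nonneg:
  fixes M :: "'a::ordered_comm_monoid_add multiset"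
  assumes "\<And>x. x \<in># M \<Longrightarrow> 0 \<le> x"
  shows "0 \<le> \<Sum>\<^sub># M"
  using assms by (induction M) auto

lemma edge_weight_nonneg:
  assumes "weighted_multigraph G"
  shows "0 \<le> edge_weight G i j"
  unfolding edge_weight_def
  by (rule sum_mset_nonneg) (use assms in \<open>auto simp: weighted_multigraph_def\<close>)

lemma transpose_laplacian: "transpose (laplacian G) = laplacian G"
  by (simp add: laplacian_def transpose_def vec_eq_iff edge_weight_commute)

text \<open>The diagonal entry supplies one copy of \<open>x $ i\<close> per neighbour, turning each
  term into a difference. The summand \<open>j = i\<close> vanishes, so the sum may run over all
  vertices.\<close>

lemma laplacian_mult_nth:
  "(laplacian G *v x) $ i = (\<Sum>j\<in>UNIV. edge_weight G i j * (x $ i - x $ j))"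
proof -
  have "(laplacian G *v x) $ i
      = laplacian G $ i $ i * x $ i + (\<Sum>j\<in>UNIV - {i}. laplacian G $ i $ j * x $ j)"
    by (simp add: matrix_vector_mult_def sum.remove[of UNIV i])
  also have "\<dots> = (\<Sum>j\<in>UNIV - {i}. edge_weight G i j * (x $ i - x $ j))"
    by (simp add: laplacian_def sum_distrib_right right_diff_distrib sum_subtractf sum_negf)
  also have "\<dots> = (\<Sum>j\<in>UNIV. edge_weight G i j * (x $ i - x $ j))"
    by (simp add: sum.remove[of UNIV i])
  finally show ?thesis .
qed

text \<open>Since weights are symmetric, each difference also occurs with the opposite sign.\<close>

lemma sum_laplacian_mult: "(\<Sum>i\<in>UNIV. (laplacian G *v x) $ i) = 0"
proof -
  have "(\<Sum>i\<in>UNIV. \<Sum>j\<in>UNIV. edge_weight G i j * x $ j)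
      = (\<Sum>i\<in>UNIV. \<Sum>j\<in>UNIV. edge_weight G i j * x $ i)"
    by (subst sum.swap) (simp add: edge_weight_commute)
  then show ?thesis
    by (simp add: laplacian_mult_nth right_diff_distrib sum_subtractf)
qed

lemma shifted_laplacian_mult_nth:
  "((mat 1 + \<alpha> *\<^sub>R laplacian G) *v x) $ i = x $ i + \<alpha> * (laplacian G *v x) $ i"
  by (simp add: matrix_vector_mult_add_rdistrib scaleR_matrix_vector_assoc[symmetric])

text \<open>Maximum principle: evaluate the equation at a vertex where \<^term>\<open>x\<close> is maximal.\<close>

lemma shifted_laplacian_kernel_nonpos:
  assumes "\<alpha> \<ge> 0" "weighted_multigraph G"
    and "(mat 1 + \<alpha> *\<^sub>R laplacian G) *v x = 0"
  shows "x $ i \<le> 0"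
proof -
  define m where "m = Max (range (($) x))"
  have "m \<in> range (($) x)"
    unfolding m_def by (rule Max_in) auto
  then obtain k where k: "m = x $ k" by auto
  have max: "x $ j \<le> x $ k" for j
    unfolding k[symmetric] m_def by simp
  have "0 \<le> (laplacian G *v x) $ k"
    unfolding laplacian_mult_nth
    by (intro sum_nonneg mult_nonneg_nonneg edge_weight_nonneg assms) (simp add: max)
  moreover have "x $ k + \<alpha> * (laplacian G *v x) $ k = 0"
    using assms(3) shifted_laplacian_mult_nth[of \<alpha> G x k] by simp
  ultimately have "x $ k \<le> 0"
    using mult_nonneg_nonneg[of \<alpha> "(laplacian G *v x) $ k"] \<open>\<alpha> \<ge> 0\<close> by linarith
  then show ?thesis using max[of i] by linarith
qed

lemma invertible_shifted_laplacian:
  assumes "\<alpha> \<ge> 0" "weighted_multigraph G"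
  shows "invertible (mat 1 + \<alpha> *\<^sub>R laplacian G)"
proof -
  let ?A = "mat 1 + \<alpha> *\<^sub>R laplacian G"
  have "x = 0" if "?A *v x = 0" for x
  proof -
    \<comment> \<open>The kernel is closed under negation, so the upper bound applies to both
      \<open>x\<close> and \<open>- x\<close>.\<close>
    have "?A *v (- x) = 0"
      using that matrix_vector_mult_diff_distrib[of ?A 0 x] by simp
    then have "x $ i = 0" for i
      using shifted_laplacian_kernel_nonpos[OF assms that, of i]
        shifted_laplacian_kernel_nonpos[OF assms, of "- x" i] by simp
    then show ?thesis by (simp add: vec_eq_iff)
  qed
  then show ?thesis
    by (metis invertible_left_inverse matrix_left_invertible_ker)
qed

lemma mult_matrix_inv:
  assumes "invertible A"
  shows "A ** matrix_inv A = mat 1"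
  using someI_ex[OF assms[unfolded invertible_def]] by (simp add: matrix_inv_def)

lemma edge_weight_alpha_extension_Some_Some:
  "edge_weight (alpha_extension \<alpha> G) (Some i) (Some j) = \<alpha> * edge_weight G i j"
proof -
  \<comment> \<open>Injectivity of \<open>Some\<close> turns the filter on extended edges into one
    on the edges of \<open>G\<close>; edges at \<open>None\<close> never match.\<close>
  have "{Some i, Some j} = Some ` {i, j}" by simp
  then have *: "Some ` e = {Some i, Some j} \<longleftrightarrow> e = {i, j}" for e
    by (metis inj_image_eq_iff inj_Some)
  show ?thesis
    by (simp add: edge_weight_def alpha_extension_def filter_mset_image_mset image_mset.compositionality
        comp_def case_prod_unfold sum_mset_distrib_left * doubleton_eq_iff)
qed

lemma edge_weight_alpha_extension_Some_None:
  "edge_weight (alpha_extension \<alpha> G) (Some i) None = 1"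
proof -
  \<comment> \<open>Old edges avoid \<open>None\<close>, so the filter keeps a single new
    edge.\<close>
  have 1: "Some ` e \<noteq> {Some i, None}" for e by auto
  have 2: "{None, Some k} = {Some i, None} \<longleftrightarrow> k = i" for k by (auto simp: doubleton_eq_iff)
  show ?thesis
    by (simp add: edge_weight_def alpha_extension_def filter_mset_image_mset image_mset.compositionality
        comp_def case_prod_unfold 1 2 filter_mset_mset_set)
qed

lemma sum_UNIV_option:
  fixes f :: "'a::finite option \<Rightarrow> 'b::comm_monoid_add"
  shows "sum f UNIV = f None + (\<Sum>i\<in>UNIV. f (Some i))"
  by (simp add: UNIV_option_conv sum.reindex)

text \<open>The new vertex is grounded at potential 0, so its unit edge to \<open>Some l\<close>
  contributes exactly \<open>x $ l\<close>: this is the summand \<open>mat 1\<close>.\<close>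

lemma laplacian_alpha_extension_mult:
  "laplacian (alpha_extension \<alpha> G) *v (\<chi> k. case k of None \<Rightarrow> 0 | Some l \<Rightarrow> x $ l)
    = (\<chi> k. case k of None \<Rightarrow> - (\<Sum>l\<in>UNIV. x $ l)
                  | Some l \<Rightarrow> ((mat 1 + \<alpha> *\<^sub>R laplacian G) *v x) $ l)"
proof -
  have "edge_weight (alpha_extension \<alpha> G) None (Some i) = 1" for i
    by (simp add: edge_weight_commute[of _ None] edge_weight_alpha_extension_Some_None)
  then show ?thesis
    by (simp add: vec_eq_iff laplacian_mult_nth shifted_laplacian_mult_nth sum_UNIV_option
        edge_weight_alpha_extension_Some_Some edge_weight_alpha_extension_Some_None
        sum_distrib_left sum_negf mult.assoc split: option.split)
qed

text \<open>Symmetry moves the outer \<open>M\<close> across the inner product, where the first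
  Penrose equation applies.\<close>

lemma inner_moore_penrose_symmetric:
  assumes "transpose M = M"
  shows "(M *v y) \<bullet> (moore_penrose M *v (M *v y)) = y \<bullet> (M *v y)"
proof -
  have "(M *v y) \<bullet> (moore_penrose M *v (M *v y)) = y \<bullet> (M *v (moore_penrose M *v (M *v y)))"
    by (metis assms dot_lmul_matrix transpose_matrix_vector)
  also have "M *v (moore_penrose M *v (M *v y)) = M *v y"
    using is_moore_penrose_moore_penrose[of M]
    by (simp add: is_moore_penrose_def matrix_vector_mul_assoc matrix_mul_assoc)
  finally show ?thesis .
qed

text \<open>Brings resistance and forest distance into the common shape of a quadratic form.\<close>

lemma inner_axis_diff_matrix:
  fixes M :: "real^'n^'n"
  shows "(axis i 1 - axis j 1) \<bullet> (M *v (axis i 1 - axis j 1))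
    = M $ i $ i + M $ j $ j - M $ i $ j - M $ j $ i"
  by (simp add: matrix_vector_mult_diff_distrib inner_diff_left inner_axis' matrix_vector_mult_basis column_def)

text \<open>The two-edge path through \<open>None\<close> rules out an infinite resistance.\<close>

lemma same_component_alpha_extension:
  "same_component (alpha_extension \<alpha> G) (Some i) (Some j)"
proof -
  let ?E = "{(u, v). \<exists>w. ({u, v}, w) \<in># alpha_extension \<alpha> G}"
  have N: "({None, Some k}, 1) \<in># alpha_extension \<alpha> G" for k
    by (auto simp: alpha_extension_def)
  have "(Some i, None) \<in> ?E" "(None, Some j) \<in> ?E"
    using N[of i] N[of j] by (auto simp: insert_commute)
  then show ?thesis
    unfolding same_component_def by (meson converse_rtrancl_into_rtrancl r_into_rtrancl)
qed

theorem proposition13: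
  fixes G :: "('v::finite) wgraph" and \<alpha> :: real and i j :: 'v
  assumes "\<alpha> > 0" and "weighted_multigraph G"
  shows "resistance_distance (alpha_extension \<alpha> G) (Some i) (Some j)
           = ereal (2 * forest_distance \<alpha> G i j)"
proof -
  define A where "A = mat 1 + \<alpha> *\<^sub>R laplacian G"
  define L where "L = laplacian (alpha_extension \<alpha> G)"
  define u :: "real^'v" where "u = axis i 1 - axis j 1"
  define u' :: "real^'v option" where "u' = axis (Some i) 1 - axis (Some j) 1"
  define x where "x = matrix_inv A *v u"
  define y :: "real^'v option" where "y = (\<chi> k. case k of None \<Rightarrow> 0 | Some l \<Rightarrow> x $ l)"
  have "invertible A"
    unfolding A_def by (rule invertible_shifted_laplacian) (use assms in auto)
  then have Ax: "A *v x = u"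
    by (simp add: x_def matrix_vector_mul_assoc mult_matrix_inv)
  have "(\<Sum>l\<in>UNIV. x $ l) = (\<Sum>l\<in>UNIV. (A *v x) $ l)"
    by (simp add: A_def shifted_laplacian_mult_nth sum.distrib sum_laplacian_mult
        flip: sum_distrib_left)
  also have "\<dots> = 0"
    by (simp add: Ax u_def axis_def sum_subtractf)
  \<comment> \<open>The vanishing sum makes the \<open>None\<close> coordinate of
    \<open>L *v y\<close> equal to 0, as in \<open>u'\<close>.\<close>
  finally have Ly: "L *v y = u'"
    using Ax unfolding L_def y_def laplacian_alpha_extension_mult A_def[symmetric]
    by (simp add: vec_eq_iff u_def u'_def axis_def split: option.split)
  have "u' \<bullet> (moore_penrose L *v u') = y \<bullet> u'"
    using inner_moore_penrose_symmetric[OF transpose_laplacian, of "alpha_extension \<alpha> G" y]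
    by (simp add: Ly flip: L_def)
  also have "\<dots> = u \<bullet> x"
    by (simp add: u_def u'_def y_def inner_diff_left inner_diff_right inner_axis inner_axis')
  finally have "u' \<bullet> (moore_penrose L *v u') = u \<bullet> (matrix_inv A *v u)"
    by (simp add: x_def)
  then show ?thesis
    unfolding u_def u'_def inner_axis_diff_matrix
    by (simp add: resistance_distance_def same_component_alpha_extension forest_distance_def
        forest_accessibility_def Let_def flip: A_def L_def)
qed

end
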